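(* Let $D$ be a discrete space of cardinality $|D|\ge\mathrm{non}(\mathcal M)$ and let $\alpha D$ be its one-point compactification. Then the product $[0,1]\times\alpha D$ contains a closed subspace $X\subseteq [0,1]\times\alpha D$ which has weight $w(X)=\mathrm{non}(\mathcal M)$ and is not supercompact.
   Context: A topological space $X$ is supercompact if it has a subbase $\mathcal B$ of its topology such that each cover of $X$ by elements of $\mathcal B$ has a subcover consisting of at most two elements. For a discrete space $D$, $\alpha D=\{\infty\}\cup D$ (with $\infty\notin D$) is the space in which a set $U$ is open iff $\infty\notin U$ or $\alpha D\setminus U$ is finite. $\mathrm{non}(\mathcal M)$ is the smallest cardinality of a non-meager subset of the real line. The weight $w(X)$ is the smallest cardinality of a base of the topology of $X$. *)

theory Defs
  imports "HOL-Analysis.Analysis"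
begin

unbundle cardinal_syntax

definition nowhere_dense :: "'a::topological_space set \<Rightarrow> bool" where
  "nowhere_dense A \<longleftrightarrow> interior (closure A) = {}"

definition meager :: "'a::topological_space set \<Rightarrow> bool" where
  "meager A \<longleftrightarrow> (\<exists>\<N>. countable \<N> \<and> (\<forall>N\<in>\<N>. nowhere_dense N) \<and> A = \<Union>\<N>)"

text \<open>
  The least cardinality of a set satisfying \<open>P\<close>, as a cardinal order in the sense of
  \<^theory>\<open>HOL.BNF_Cardinal_Order_Relation\<close>; unspecified if no set satisfies \<open>P\<close>.
  Cardinals living on different types are compared with \<open>=o\<close> and \<open>\<le>o\<close>.
\<close>

definition least_cardinality :: "('a set \<Rightarrow> bool) \<Rightarrow> 'a rel" where
  "least_cardinality P = |SOME A. P A \<and> (\<forall>B. P B \<longrightarrow> |A| \<le>o |B| )|"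

lemma least_cardinality:
  assumes "P A0"
  obtains A where "P A" "least_cardinality P = |A|" "\<And>B. P B \<Longrightarrow> |A| \<le>o |B|"
proof -
  have "\<exists>r\<in>card_of ` Collect P. \<forall>r'\<in>card_of ` Collect P. r \<le>o r'"
    using assms by (intro exists_minim_Card_order) (auto simp: card_of_Card_order)
  then have "\<exists>A. P A \<and> (\<forall>B. P B \<longrightarrow> |A| \<le>o |B| )"
    by blast
  then have "P (SOME A. P A \<and> (\<forall>B. P B \<longrightarrow> |A| \<le>o |B| )) \<and>
      (\<forall>B. P B \<longrightarrow> |SOME A. P A \<and> (\<forall>B. P B \<longrightarrow> |A| \<le>o |B| )| \<le>o |B| )"
    by (rule someI_ex)
  then show thesis
    using that unfolding least_cardinality_def by blast
qed

definition non_M :: "real rel" where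
  "non_M = least_cardinality (\<lambda>A::real set. \<not> meager A)"

lemma not_meager_UNIV_real: "\<not> meager (UNIV :: real set)"
proof
  assume "meager (UNIV :: real set)"
  then obtain \<N> :: "real set set"
    where \<N>: "countable \<N>" "\<forall>N\<in>\<N>. interior (closure N) = {}" "UNIV = \<Union>\<N>"
    unfolding meager_def nowhere_dense_def by (elim exE conjE)
  have "UNIV \<subseteq> closure (\<Inter>((\<lambda>N. - closure N) ` \<N>))"
  proof (rule Baire)
    fix T assume "T \<in> (\<lambda>N. - closure N) ` \<N>"
    then obtain N where N: "N \<in> \<N>" "T = - closure N"
      by blast
    have "closure T = UNIV"
      unfolding N(2) closure_complement by (simp only: bspec[OF \<N>(2) N(1)] Compl_empty_eq)
    moreover have "open T"
      unfolding N(2) by (rule open_Compl[OF closed_closure])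
    ultimately show "openin (top_of_set UNIV) T \<and> UNIV \<subseteq> closure T"
      by simp
  next
    show "closed (UNIV :: real set)" by simp
  next
    show "countable ((\<lambda>N. - closure N) ` \<N>)" using \<N>(1) by (rule countable_image)
  qed
  moreover have "\<Inter>((\<lambda>N. - closure N) ` \<N>) = {}"
  proof (rule equals0I)
    fix x assume x: "x \<in> \<Inter>((\<lambda>N. - closure N) ` \<N>)"
    have "x \<in> \<Union>\<N>"
      by (rule subst[OF \<N>(3)]) (rule UNIV_I)
    then obtain N where "N \<in> \<N>" "x \<in> N"
      by (rule UnionE)
    with x closure_subset[of N] show False by blast
  qed
  ultimately show False
    by (metis UNIV_not_empty closure_empty subset_empty)
qed

definition is_base :: "'a topology \<Rightarrow> 'a set set \<Rightarrow> bool" where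
  "is_base X \<B> \<longleftrightarrow> openin X = arbitrary union_of (\<lambda>U. U \<in> \<B>)"

text \<open>
  Intersecting with the whole space only affects the empty intersection, which is read as
  \<open>topspace X\<close>; a subbase is thus not required to cover the space.
\<close>

definition is_subbase :: "'a topology \<Rightarrow> 'a set set \<Rightarrow> bool" where
  "is_subbase X \<B> \<longleftrightarrow> (\<forall>U\<in>\<B>. openin X U) \<and>
     openin X = arbitrary union_of
       (finite intersection_of (\<lambda>U. U \<in> \<B>) relative_to topspace X)"

definition weight :: "'a topology \<Rightarrow> 'a set rel" where
  "weight X = least_cardinality (is_base X)"

definition supercompact :: "'a topology \<Rightarrow> bool" where
  "supercompact X \<longleftrightarrow> (\<exists>\<B>. is_subbase X \<B> \<and>
     (\<forall>\<C>\<subseteq>\<B>. topspace X \<subseteq> \<Union>\<C> \<longrightarrow>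
        (\<exists>\<D>\<subseteq>\<C>. finite \<D> \<and> card \<D> \<le> 2 \<and> topspace X \<subseteq> \<Union>\<D>)))"

text \<open>
  The topology of the one-point compactification \<open>{\<infinity>} \<union> D\<close> of a discrete space \<open>D\<close>,
  with \<open>None\<close> as the point \<open>\<infinity>\<close>.
\<close>

lemma openin_Alexandroff_compactification_discrete:
  "openin (Alexandroff_compactification (discrete_topology D)) U \<longleftrightarrow>
     U \<subseteq> insert None (Some ` D) \<and> (None \<notin> U \<or> finite (insert None (Some ` D) - U))"
proof
  assume "openin (Alexandroff_compactification (discrete_topology D)) U"
  then show "U \<subseteq> insert None (Some ` D) \<and> (None \<notin> U \<or> finite (insert None (Some ` D) - U))"
    unfolding openin_Alexandroff_compactification
  proof (elim disjE exE conjE)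
    fix C assume C: "compactin (discrete_topology D) C"
      and U: "U = insert None (Some ` (topspace (discrete_topology D) - C))"
    have "insert None (Some ` D) - U \<subseteq> Some ` C"
      using U by auto
    moreover have "finite (Some ` C)"
      using C by (simp add: compactin_discrete_topology)
    ultimately have "finite (insert None (Some ` D) - U)"
      by (rule finite_subset)
    moreover have "U \<subseteq> insert None (Some ` D)"
      using U by auto
    ultimately show ?thesis by simp
  qed auto
next
  assume R: "U \<subseteq> insert None (Some ` D) \<and> (None \<notin> U \<or> finite (insert None (Some ` D) - U))"
  show "openin (Alexandroff_compactification (discrete_topology D)) U"
  proof (cases "None \<in> U")
    case False
    with R have "U = Some ` {d \<in> D. Some d \<in> U}" by auto
    then show ?thesis
      unfolding openin_Alexandroff_compactification openin_discrete_topology by blast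
  next
    case True
    define C where "C = {d \<in> D. Some d \<notin> U}"
    have "Some ` C \<subseteq> insert None (Some ` D) - U" by (auto simp: C_def)
    moreover have "finite (insert None (Some ` D) - U)" using R True by blast
    ultimately have "finite (Some ` C)" by (rule finite_subset)
    then have "finite C" by (rule finite_imageD) simp
    moreover have "C \<subseteq> D" unfolding C_def by blast
    ultimately have "compactin (discrete_topology D) C" "closedin (discrete_topology D) C"
      by (simp_all add: compactin_discrete_topology)
    moreover have "U = insert None (Some ` (topspace (discrete_topology D) - C))"
      using R True by (auto simp: C_def)
    ultimately show ?thesis
      unfolding openin_Alexandroff_compactification by blast
  qed
qed

end

theory Submission
  imports Defs
begin

text \<open>
  Let \<open>A\<close> be a non-meager set of reals of least cardinality. The binary digits of \<open>x \<in> A\<close> are read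
  as instructions for removing rational open intervals with disjoint closures from \<open>[0,1]\<close>; this
  gives a compact set \<open>C x\<close> which contains all end points of its gaps. The space is
  \<open>[0,1] \<times> {\<infinity>}\<close> together with a clopen copy of \<open>C x\<close> in the fiber of a point of \<open>D\<close>, for each
  \<open>x \<in> A\<close>.

  Suppose that finite intersections of subbasic closed sets have the property that three of them meet
  as soon as they meet pairwise. Each fiber is a finite union of such sets, so one of them, \<open>M x\<close>,
  contains the part of the fiber over some basic open \<open>S\<close> meeting \<open>C x\<close>. As \<open>A\<close> is
  non-meager, the same \<open>S\<close> works for a somewhere dense set of \<open>x\<close>, and within it finitely many gaps
  inside some ball of \<open>S\<close> can still be prescribed. Cover a smaller ball by finitely many closed sets
  \<open>L\<close> lying over \<open>S\<close>; let \<open>e\<close> be the largest point of the section of \<open>L\<close> at infinity, and prescribe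
  for each such \<open>e\<close> a gap \<open>(p,q)\<close> around it, with \<open>q\<close> so close to \<open>e\<close> that sets \<open>L'\<close> of a finer
  cover which contain the point of the fiber over \<open>q\<close> must contain \<open>(e,\<infinity>)\<close>. Then \<open>L\<close>, \<open>L'\<close> and
  \<open>M x\<close> meet pairwise, but a common point would lie to the right of \<open>e\<close>, where \<open>L\<close> misses all but
  finitely many fibers.
\<close>

section \<open>Finite intersections of subbasic closed sets\<close>

text \<open>\<open>K\<close> is an intersection of finitely many complements of subbase members.\<close>

definition kset :: "'a topology \<Rightarrow> 'a set set \<Rightarrow> 'a set \<Rightarrow> bool" where
  "kset X \<B> K \<longleftrightarrow> (\<exists>N\<subseteq>\<B>. finite N \<and> K = topspace X - \<Union>N)"

lemma closedin_kset:
  assumes "is_subbase X \<B>" "kset X \<B> K"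
  shows "closedin X K"
proof -
  obtain N where "N \<subseteq> \<B>" "K = topspace X - \<Union>N"
    using assms unfolding kset_def by auto
  moreover have "openin X (\<Union>N)"
    using assms(1) \<open>N \<subseteq> \<B>\<close> unfolding is_subbase_def by (intro openin_Union) auto
  ultimately show ?thesis by auto
qed

text \<open>In complements, an empty triple intersection makes \<open>N1\<close>, \<open>N2\<close>
  and \<open>N3\<close> together a cover. Two members of a cover come from at most two of these
  families, so a point in the corresponding pairwise intersection avoids both.\<close>

lemma kset_binary:
  assumes bin: "\<And>\<C>. \<C> \<subseteq> \<B> \<Longrightarrow> topspace X \<subseteq> \<Union>\<C> \<Longrightarrow>
      \<exists>\<D>\<subseteq>\<C>. finite \<D> \<and> card \<D> \<le> 2 \<and> topspace X \<subseteq> \<Union>\<D>"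
    and K: "kset X \<B> K1" "kset X \<B> K2" "kset X \<B> K3"
    and meet: "K1 \<inter> K2 \<noteq> {}" "K1 \<inter> K3 \<noteq> {}" "K2 \<inter> K3 \<noteq> {}"
  shows "K1 \<inter> K2 \<inter> K3 \<noteq> {}"
proof
  assume empty: "K1 \<inter> K2 \<inter> K3 = {}"
  from K obtain N1 N2 N3 where N: "N1 \<subseteq> \<B>" "N2 \<subseteq> \<B>" "N3 \<subseteq> \<B>"
    "K1 = topspace X - \<Union>N1" "K2 = topspace X - \<Union>N2" "K3 = topspace X - \<Union>N3"
    unfolding kset_def by (elim exE conjE) (rule that)
  have "topspace X \<subseteq> \<Union>(N1 \<union> N2 \<union> N3)"
    using empty unfolding N(4-6) by auto
  then obtain \<D> where D: "\<D> \<subseteq> N1 \<union> N2 \<union> N3" "finite \<D>" "card \<D> \<le> 2" "topspace X \<subseteq> \<Union>\<D>"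
    using bin[of "N1 \<union> N2 \<union> N3"] N by auto
  obtain z12 z13 z23 where z: "z12 \<in> K1 \<inter> K2" "z13 \<in> K1 \<inter> K3" "z23 \<in> K2 \<inter> K3"
    using meet by auto
  have pair: "\<not> topspace X \<subseteq> U \<union> V" if "U \<in> N1 \<union> N2 \<union> N3" "V \<in> N1 \<union> N2 \<union> N3" for U V
  proof -
    have "z12 \<notin> U \<union> V \<or> z13 \<notin> U \<union> V \<or> z23 \<notin> U \<union> V"
      using that z unfolding N(4-6) by (elim UnE) auto
    moreover have "z12 \<in> topspace X" "z13 \<in> topspace X" "z23 \<in> topspace X"
      using z unfolding N(4-6) by auto
    ultimately show ?thesis by auto
  qed
  \<comment> \<open>A single member is listed as the pair \<open>{U, U}\<close>, so
    \<open>pair\<close> also settles subcovers of size one.\<close>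
  have "\<exists>U V. \<D> = {} \<or> \<D> = {U, V}"
  proof -
    consider "card \<D> = 0" | "card \<D> = 1" | "card \<D> = 2"
      using D(3) by linarith
    then show ?thesis
    proof cases
      case 2
      then show ?thesis by (metis card_1_singletonE insert_absorb2)
    next
      case 3
      then show ?thesis by (metis card_2_iff)
    qed (use D(2) in auto)
  qed
  then obtain U V where "\<D> = {} \<or> \<D> = {U, V}"
    by blast
  then show False
  proof
    assume "\<D> = {}"
    then show False using D(4) z unfolding N(4-6) by auto
  next
    assume "\<D> = {U, V}"
    then show False using pair[of U V] D(1,4) by auto
  qed
qed

text \<open>By distributivity: removing a finite intersection \<open>V\<close> from \<open>K\<close>
  leaves the union of the sets \<open>K - B\<close> with \<open>B\<close> one of its factors, and
  each of these only adds one more subbase member to be avoided.\<close>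

lemma kset_union_complement:
  assumes "finite \<V>" "\<And>V. V \<in> \<V> \<Longrightarrow> \<exists>N\<subseteq>\<B>. finite N \<and> V = topspace X \<inter> \<Inter>N"
  shows "\<exists>\<F>. finite \<F> \<and> (\<forall>K\<in>\<F>. kset X \<B> K) \<and> \<Union>\<F> = topspace X - \<Union>\<V>"
  using assms
proof (induction \<V>)
  case empty
  have "kset X \<B> (topspace X)"
    unfolding kset_def by (rule exI[of _ "{}"]) auto
  then show ?case
    by (intro exI[of _ "{topspace X}"]) auto
next
  case (insert V \<V>)
  then obtain \<F> where F: "finite \<F>" "\<forall>K\<in>\<F>. kset X \<B> K" "\<Union>\<F> = topspace X - \<Union>\<V>"
    by auto
  obtain N where N: "N \<subseteq> \<B>" "finite N" "V = topspace X \<inter> \<Inter>N"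
    using insert.prems by blast
  let ?F = "(\<lambda>(K, B). K - B) ` (\<F> \<times> N)"
  have "finite ?F" using F N by simp
  moreover have "kset X \<B> (K - B)" if KB: "K \<in> \<F>" "B \<in> N" for K B
  proof -
    have "kset X \<B> K" using KB F by blast
    then obtain N0 where "N0 \<subseteq> \<B>" "finite N0" "K = topspace X - \<Union>N0"
      unfolding kset_def by auto
    then show ?thesis
      unfolding kset_def using KB N by (intro exI[of _ "insert B N0"]) auto
  qed
  moreover have "\<Union>?F = topspace X - \<Union>(insert V \<V>)"
  proof -
    have "\<Union>?F = \<Union>\<F> - \<Inter>N" by auto
    then show ?thesis using F(3) N(3) by auto
  qed
  ultimately show ?case
    by (intro exI[of _ ?F]) auto
qed

text \<open>The complement of \<open>C\<close> is a union of finite intersections of subbase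
  members. Finitely many of them cover the compact complement of \<open>U\<close>, and
  \<open>kset_union_complement\<close> describes what they leave.\<close>

lemma kset_sandwich:
  assumes "compact_space X" and sub: "is_subbase X \<B>" and "closedin X C" "openin X U" "C \<subseteq> U"
  obtains \<F> where "finite \<F>" "\<And>K. K \<in> \<F> \<Longrightarrow> kset X \<B> K" "C \<subseteq> \<Union>\<F>" "\<Union>\<F> \<subseteq> U"
proof -
  have Z: "compactin X (topspace X - U)"
    using assms by (blast intro: closedin_compact_space)
  have "openin X (topspace X - C)"
    using assms by blast
  then have "(arbitrary union_of (finite intersection_of (\<lambda>U. U \<in> \<B>) relative_to topspace X)) (topspace X - C)"
    using sub unfolding is_subbase_def by metis
  then obtain \<V> where V: "\<V> \<subseteq> Collect (finite intersection_of (\<lambda>U. U \<in> \<B>) relative_to topspace X)"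
      "\<Union>\<V> = topspace X - C"
    unfolding union_of_def by auto
  have V': "\<exists>N\<subseteq>\<B>. finite N \<and> V = topspace X \<inter> \<Inter>N" if "V \<in> \<V>" for V
  proof -
    have "(finite intersection_of (\<lambda>U. U \<in> \<B>) relative_to topspace X) V"
      using V(1) that by auto
    then show ?thesis
      unfolding relative_to_def intersection_of_def by (auto simp: subset_eq)
  qed
  have "openin X V" if "V \<in> \<V>" for V
  proof -
    obtain N where N: "N \<subseteq> \<B>" "finite N" "V = topspace X \<inter> \<Inter>N"
      using V'[OF \<open>V \<in> \<V>\<close>] by blast
    \<comment> \<open>\<open>openin_Inter\<close> concerns nonempty families; for empty
      \<open>N\<close> the set \<open>V\<close> is the whole space.\<close>
    show ?thesis
    proof (cases "N = {}")
      case False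
      then have "openin X (\<Inter>N)"
        using N sub unfolding is_subbase_def by (intro openin_Inter) auto
      then show ?thesis using N by auto
    qed (use N in auto)
  qed
  then obtain \<V>' where W: "finite \<V>'" "\<V>' \<subseteq> \<V>" "topspace X - U \<subseteq> \<Union>\<V>'"
    using compactinD[OF Z, of \<V>] V(2) \<open>C \<subseteq> U\<close> by (metis Diff_mono subset_refl)
  then obtain \<F> where F: "finite \<F>" "\<forall>K\<in>\<F>. kset X \<B> K" "\<Union>\<F> = topspace X - \<Union>\<V>'"
    using kset_union_complement[of \<V>' \<B> X] V' by (meson subsetD)
  show ?thesis
  proof (rule that[OF F(1)])
    show "C \<subseteq> \<Union>\<F>"
      unfolding F(3) using W(2) V(2) closedin_subset[OF \<open>closedin X C\<close>] by blast
    show "\<Union>\<F> \<subseteq> U" unfolding F(3) using W(3) by blast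
  qed (use F in auto)
qed

text \<open>A Baire argument for finitely many pieces: if \<open>f M\<close> does not contain
  \<open>Z\<close>, then the part of \<open>Z\<close> outside it is relatively open and is covered
  by the remaining pieces.\<close>

lemma finite_closed_cover_open_piece:
  fixes Z :: "'a::topological_space set"
  assumes "finite \<F>" "\<And>M. M \<in> \<F> \<Longrightarrow> closed (f M)" "Z \<noteq> {}" "Z \<subseteq> (\<Union>M\<in>\<F>. f M)"
  shows "\<exists>M\<in>\<F>. \<exists>O'. open O' \<and> Z \<inter> O' \<noteq> {} \<and> Z \<inter> O' \<subseteq> f M"
  using assms
proof (induction \<F> arbitrary: Z)
  case (insert M \<F>)
  show ?case
  proof (cases "Z \<subseteq> f M")
    case True
    then show ?thesis using insert.prems(2) by (intro bexI[of _ M] exI[of _ UNIV]) simp_all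
  next
    case False
    then have "Z - f M \<noteq> {}" "Z - f M \<subseteq> (\<Union>M\<in>\<F>. f M)"
      using insert.prems(3) by auto
    then obtain M' O' where "M' \<in> \<F>" "open O'" "(Z - f M) \<inter> O' \<noteq> {}" "(Z - f M) \<inter> O' \<subseteq> f M'"
      using insert.IH[of "Z - f M"] insert.prems(1) by (meson insertCI)
    moreover have "open (O' - f M)"
      using \<open>open O'\<close> insert.prems(1) by (simp add: open_Diff)
    moreover have "Z \<inter> (O' - f M) = (Z - f M) \<inter> O'"
      by blast
    ultimately show ?thesis
      by (intro bexI[of _ M'] exI[of _ "O' - f M"]) simp_all
  qed
qed simp

section \<open>Compact sets coded by reals\<close>

lemma countable_imp_meager:
  assumes "countable (A :: real set)"
  shows "meager A"
  unfolding meager_def nowhere_dense_def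
  using assms by (intro exI[of _ "(\<lambda>x. {x}) ` A"]) auto

text \<open>Otherwise countably many nowhere dense pieces would make up \<open>A\<close>.\<close>

lemma not_meager_dense_piece:
  assumes "\<not> meager A" "countable I" "A \<subseteq> (\<Union>i\<in>I. P i)"
  obtains i where "i \<in> I" "interior (closure (A \<inter> P i)) \<noteq> {}"
proof (rule ccontr)
  assume "\<not> thesis"
  then have "\<forall>i\<in>I. nowhere_dense (A \<inter> P i)"
    using that unfolding nowhere_dense_def by blast
  moreover have "A = \<Union>((\<lambda>i. A \<inter> P i) ` I)"
    using assms(3) by blast
  ultimately show False
    using assms(1,2) unfolding meager_def
    by (metis (mono_tags, lifting) countable_image imageE)
qed

section \<open>Binary digits and dyadic intervals\<close>

definition bits :: "real \<Rightarrow> nat \<Rightarrow> bool" where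
  "bits x k \<longleftrightarrow> odd \<lfloor>2 ^ Suc k * x\<rfloor>"

text \<open>The half-open interval from \<open>j / 2^n\<close> to \<open>(j + 1) / 2^n\<close>. The
  floor form turns its refinement into integer arithmetic.\<close>

definition dyadic :: "nat \<Rightarrow> int \<Rightarrow> real set" where
  "dyadic n j = {x. \<lfloor>2 ^ n * x\<rfloor> = j}"

lemma floor_double_div: "\<lfloor>2 * (y::real)\<rfloor> div 2 = \<lfloor>y\<rfloor>"
  by linarith

text \<open>An integer is determined by its quotient by 2 and its parity. Hence halving a dyadic
  interval amounts to fixing one more binary digit.\<close>

lemma dyadic_Suc:
  "dyadic (Suc n) j = {x \<in> dyadic n (j div 2). bits x n = odd j}"
proof -
  have half: "\<lfloor>2 ^ n * x\<rfloor> = \<lfloor>2 ^ Suc n * x\<rfloor> div 2" for x :: real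
    using floor_double_div[of "2 ^ n * x"] by (simp add: mult.assoc)
  have eq: "a = b \<longleftrightarrow> a div 2 = b div 2 \<and> odd a = odd b" for a b :: int
    by presburger
  show ?thesis
    unfolding dyadic_def bits_def half
    by (subst eq) simp
qed

lemma bits_dyadic_cong:
  assumes "x \<in> dyadic n j" "y \<in> dyadic n j" "k < n"
  shows "bits x k = bits y k"
  using assms
proof (induction n arbitrary: j)
  case (Suc n)
  then show ?case
    using Suc.IH[of "j div 2"] by (auto simp: dyadic_Suc less_Suc_eq)
qed simp

lemma dyadic_extend:
  assumes "n \<le> m"
  shows "\<exists>j'. dyadic m j' \<subseteq> {x \<in> dyadic n j. \<forall>k. n \<le> k \<and> k < m \<longrightarrow> bits x k = g k}"
  using assms
proof (induction m rule: dec_induct)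
  case (step m)
  then obtain j' where j': "dyadic m j' \<subseteq> {x \<in> dyadic n j. \<forall>k. n \<le> k \<and> k < m \<longrightarrow> bits x k = g k}"
    by blast
  \<comment> \<open>Appending the digit \<open>g m\<close> selects the left or the right
    half.\<close>
  define j'' where "j'' = 2 * j' + of_bool (g m)"
  have "j'' div 2 = j'" "odd j'' = g m"
    unfolding j''_def by auto
  then have "dyadic (Suc m) j'' = {x \<in> dyadic m j'. bits x m = g m}"
    by (simp add: dyadic_Suc)
  then show ?case
    using j' by (intro exI[of _ j'']) (auto simp: less_Suc_eq)
qed auto

lemma dyadic_contains_interval:
  obtains a b where "a < b" "{a<..<b} \<subseteq> dyadic n j"
proof
  show "{real_of_int j / 2 ^ n <..< (real_of_int j + 1) / 2 ^ n} \<subseteq> dyadic n j"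
    unfolding dyadic_def by (auto simp: floor_eq_iff field_simps)
qed (simp add: divide_strict_right_mono)

lemma dyadic_inside_open:
  assumes "open I" "(x::real) \<in> I"
  obtains n j where "x \<in> dyadic n j" "dyadic n j \<subseteq> I"
proof -
  obtain e where e: "e > 0" "ball x e \<subseteq> I"
    using assms open_contains_ball by blast
  obtain n where n: "(1/2)^n < e"
    using e real_arch_pow_inv[of e "1/2"] by auto
  have "dyadic n \<lfloor>2 ^ n * x\<rfloor> \<subseteq> ball x e"
  proof
    fix y assume "y \<in> dyadic n \<lfloor>2 ^ n * x\<rfloor>"
    then have "\<bar>2 ^ n * x - 2 ^ n * y\<bar> < 1"
      unfolding dyadic_def by simp linarith
    then have "2 ^ n * \<bar>x - y\<bar> < 1"
      by (metis abs_mult abs_numeral power_abs right_diff_distrib)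
    then have "\<bar>x - y\<bar> < (1/2)^n"
      by (simp add: field_simps)
    then show "y \<in> ball x e"
      using n by (simp add: dist_real_def)
  qed
  then show ?thesis
    using e that[of n "\<lfloor>2 ^ n * x\<rfloor>"] unfolding dyadic_def by auto
qed

text \<open>
  Every pair of rationals occurs infinitely often as a candidate gap, because the second component
  of \<^term>\<open>prod_decode k\<close> is ignored.
\<close>

definition cand :: "nat \<Rightarrow> real \<times> real" where
  "cand k = map_prod of_rat of_rat (from_nat (fst (prod_decode k)))"

lemma cand_surj:
  assumes "p \<in> \<rat>" "q \<in> \<rat>"
  obtains k where "n \<le> k" "cand k = (p, q)"
proof -
  obtain p' q' where "p = of_rat p'" "q = of_rat q'"
    using assms by (auto elim!: Rats_cases)
  \<comment> \<open>The ignored second component is set to \<open>n\<close>, which forces the index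
    to be at least \<open>n\<close>.\<close>
  then have "cand (prod_encode (to_nat (p', q'), n)) = (p, q)"
    unfolding cand_def by simp
  then show ?thesis
    using that le_prod_encode_2 by blast
qed

section \<open>Compact sets obtained by removing gaps\<close>

primrec gaps :: "(nat \<Rightarrow> bool) \<Rightarrow> nat \<Rightarrow> (real \<times> real) set" where
  "gaps b 0 = {}"
| "gaps b (Suc k) =
    (if b k \<and> 0 < fst (cand k) \<and> fst (cand k) < snd (cand k) \<and> snd (cand k) < 1 \<and>
        (\<forall>(p, q)\<in>gaps b k. snd (cand k) < p \<or> q < fst (cand k))
     then insert (cand k) (gaps b k) else gaps b k)"

text \<open>Despite the name this need not be a Cantor set: if no digit is set, it is all of
  \<open>{0..1}\<close>.\<close>

definition cantor :: "(nat \<Rightarrow> bool) \<Rightarrow> real set" where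
  "cantor b = {0..1} - (\<Union>k. \<Union>(p, q)\<in>gaps b k. {p<..<q})"

lemma closed_cantor: "closed (cantor b)"
  unfolding cantor_def by (intro closed_Diff open_UN) auto

lemma finite_gaps: "finite (gaps b k)"
  by (induction k) auto

lemma gaps_cong: "(\<And>i. i < k \<Longrightarrow> b i = c i) \<Longrightarrow> gaps b k = gaps c k"
  by (induction k) auto

lemma gaps_mono: "j \<le> k \<Longrightarrow> gaps b j \<subseteq> gaps b k"
  by (induction k rule: dec_induct) auto

lemma gaps_idle:
  assumes "n \<le> k" "\<And>i. n \<le> i \<Longrightarrow> i < k \<Longrightarrow> \<not> b i"
  shows "gaps b k = gaps b n"
  using assms by (induction k rule: dec_induct) auto

lemma gaps_bounds:
  assumes "(p, q) \<in> gaps b k"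
  shows "0 < p \<and> p < q \<and> q < 1"
  using assms
proof (induction k)
  case (Suc k)
  then show ?case
    by (cases "cand k") (auto split: if_splits)
qed simp

lemma gaps_separated:
  assumes "(p, q) \<in> gaps b k" "(p', q') \<in> gaps b k" "(p, q) \<noteq> (p', q')"
  shows "q < p' \<or> q' < p"
  using assms
proof (induction k)
  case (Suc k)
  show ?case
  proof (cases "(p, q) \<in> gaps b k \<and> (p', q') \<in> gaps b k")
    case True
    then show ?thesis using Suc by blast
  next
    case False
    then show ?thesis
      using Suc.prems by (cases "cand k") (fastforce split: if_splits)
  qed
qed simp

text \<open>The strict inequalities in \<open>gaps\<close> give distinct gaps disjoint closures, so
  no end point is removed by another gap. Gaps accepted at different stages are compared at the
  later one.\<close>

lemma gap_endpoints_in_cantor: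
  assumes "(p, q) \<in> gaps b k"
  shows "p \<in> cantor b" "q \<in> cantor b"
proof -
  have "p \<notin> {p'<..<q'} \<and> q \<notin> {p'<..<q'}" if "(p', q') \<in> gaps b j" for p' q' j
  proof (cases "(p, q) = (p', q')")
    case False
    have "(p, q) \<in> gaps b (max j k)" "(p', q') \<in> gaps b (max j k)"
      using assms that gaps_mono[of j "max j k" b] gaps_mono[of k "max j k" b] by auto
    then have "q < p' \<or> q' < p" "p < q" "p' < q'"
      using gaps_separated False gaps_bounds by blast+
    then show ?thesis by auto
  qed auto
  then show "p \<in> cantor b" "q \<in> cantor b"
    using gaps_bounds[OF assms] unfolding cantor_def by auto
qed

lemma cantor_gap:
  assumes "(p, q) \<in> gaps b k"
  shows "cantor b \<inter> {p<..<q} = {}"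
  using assms unfolding cantor_def by blast

lemma zero_in_cantor: "0 \<in> cantor b"
  using gaps_bounds unfolding cantor_def by force

text \<open>A point left after all removals can lie in a closed gap of stage \<open>n\<close> only
  as an end point, and in at most one. A small move outwards from that gap, or inwards from 0 or 1,
  leaves every closed gap of the stage.\<close>

lemma free_point:
  assumes "z \<in> cantor b" "open S" "z \<in> S"
  obtains w where "w \<in> S" "0 < w" "w < 1" "\<And>p q. (p, q) \<in> gaps b n \<Longrightarrow> w \<notin> {p..q}"
proof -
  \<comment> \<open>\<open>H\<close> collects the closed gaps that avoid \<open>z\<close>. It is
    closed, so a ball around \<open>z\<close> misses it.\<close>
  define H where "H = (\<Union>(p, q)\<in>{(p, q) \<in> gaps b n. z \<notin> {p..q}}. {p..q})"
  have "finite {(p, q) \<in> gaps b n. z \<notin> {p..q}}"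
    by (rule finite_subset[OF _ finite_gaps[of b n]]) auto
  then have "closed H"
    unfolding H_def by (intro closed_UN) auto
  then have "open (S - H)" "z \<in> S - H"
    using assms unfolding H_def by (blast, auto)
  then obtain e where e: "e > 0" "ball z e \<subseteq> S - H"
    using open_contains_ball by blast
  have z: "0 \<le> z" "z \<le> 1" "\<And>p q. (p, q) \<in> gaps b n \<Longrightarrow> z \<notin> {p<..<q}"
    using assms(1) cantor_gap[of _ _ b n] by (simp add: cantor_def, simp add: cantor_def, blast)
  have ball: "w \<in> S \<and> (\<forall>p q. (p, q) \<in> gaps b n \<longrightarrow> z \<notin> {p..q} \<longrightarrow> w \<notin> {p..q})"
    if "\<bar>w - z\<bar> < e" for w
  proof -
    have "w \<in> ball z e" using that by (simp add: dist_real_def abs_minus_commute)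
    then show ?thesis using e unfolding H_def by fast
  qed
  show ?thesis
  proof (cases "\<exists>p q. (p, q) \<in> gaps b n \<and> z \<in> {p..q}")
    case True
    then obtain p q where pq: "(p, q) \<in> gaps b n" "z \<in> {p..q}" by blast
    have b: "0 < p" "p < q" "q < 1" using gaps_bounds[OF pq(1)] by auto
    have other: "z \<notin> {p'..q'}" if "(p', q') \<in> gaps b n" "(p', q') \<noteq> (p, q)" for p' q'
      using gaps_separated[OF that(1) pq(1) that(2)] gaps_bounds[OF that(1)] pq(2) by auto
    have "z = p \<or> z = q"
      using z(3)[OF pq(1)] pq(2) by auto
    then show ?thesis
    proof
      assume zp: "z = p"
      \<comment> \<open>A step to the left of the gap; the bound \<open>p/2\<close> keeps the point
        positive.\<close>
      define w where "w = z - min (e/2) (p/2)"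
      have w: "\<bar>w - z\<bar> < e" "0 < w" "w < p"
        unfolding w_def zp using e b by auto
      show ?thesis
      proof (rule that[of w])
        show "w \<notin> {p'..q'}" if "(p', q') \<in> gaps b n" for p' q'
          using ball[OF w(1)] other[OF that] that w by fastforce
      qed (use ball[OF w(1)] w b in auto)
    next
      assume zq: "z = q"
      define w where "w = z + min (e/2) ((1-q)/2)"
      have w: "\<bar>w - z\<bar> < e" "q < w" "w < 1"
        unfolding w_def zq using e b by (auto simp: min_def field_simps)
      show ?thesis
      proof (rule that[of w])
        show "w \<notin> {p'..q'}" if "(p', q') \<in> gaps b n" for p' q'
          using ball[OF w(1)] other[OF that] that w by fastforce
      qed (use ball[OF w(1)] w b in auto)
    qed
  next
    case False
    define w where "w = (if z = 0 then min (e/2) (1/2) else if z = 1 then 1 - min (e/2) (1/2) else z)"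
    have w: "\<bar>w - z\<bar> < e" "0 < w" "w < 1"
      unfolding w_def using e z by (auto simp: min_def field_simps)
    then show ?thesis
      using that[of w] ball[OF w(1)] False by auto
  qed
qed

text \<open>The gaps are scheduled one at a time. As each candidate recurs beyond any stage, its
  digit can be set at a late index, while the digits between the current stage and that index stay
  false and let no other gap in.\<close>

lemma gaps_extend:
  assumes "finite P"
    and "\<And>p q. (p, q) \<in> P \<Longrightarrow> p \<in> \<rat> \<and> q \<in> \<rat> \<and> 0 < p \<and> p < q \<and> q < 1"
    and "\<And>p q p' q'. (p, q) \<in> P \<Longrightarrow> (p', q') \<in> P \<Longrightarrow> (p, q) \<noteq> (p', q') \<Longrightarrow> q < p' \<or> q' < p"
    and "\<And>p q p' q'. (p, q) \<in> P \<Longrightarrow> (p', q') \<in> gaps f n \<Longrightarrow> q < p' \<or> q' < p"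
  shows "\<exists>m g. n \<le> m \<and> (\<forall>i<n. g i = f i) \<and> gaps g m = P \<union> gaps f n"
  using assms
proof (induction P)
  case empty
  then show ?case by auto
next
  case (insert pq P)
  obtain p q where pq: "pq = (p, q)" by (cases pq)
  have "\<exists>m g. n \<le> m \<and> (\<forall>i<n. g i = f i) \<and> gaps g m = P \<union> gaps f n"
  proof (rule insert.IH)
    show "p \<in> \<rat> \<and> q \<in> \<rat> \<and> 0 < p \<and> p < q \<and> q < 1" if "(p, q) \<in> P" for p q
      using insert.prems(1) that by blast
    show "q < p' \<or> q' < p" if "(p, q) \<in> P" "(p', q') \<in> P" "(p, q) \<noteq> (p', q')" for p q p' q'
      using insert.prems(2) that by blast
    show "q < p' \<or> q' < p" if "(p, q) \<in> P" "(p', q') \<in> gaps f n" for p q p' q'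
      using insert.prems(3) that by blast
  qed
  then obtain m g where mg: "n \<le> m" "\<forall>i<n. g i = f i" "gaps g m = P \<union> gaps f n"
    by blast
  have new: "p \<in> \<rat>" "q \<in> \<rat>" "0 < p" "p < q" "q < 1"
    using insert.prems(1)[of p q] pq by auto
  obtain k where k: "m \<le> k" "cand k = (p, q)"
    using cand_surj new by blast
  define g' where "g' = (\<lambda>i. if i < m then g i else i = k)"
  have "gaps g' k = gaps g' m"
    by (rule gaps_idle[OF k(1)]) (auto simp: g'_def)
  also have "\<dots> = gaps g m"
    by (rule gaps_cong) (auto simp: g'_def)
  finally have *: "gaps g' k = P \<union> gaps f n"
    using mg by simp
  have "q < p' \<or> q' < p" if "(p', q') \<in> P \<union> gaps f n" for p' q'
  proof (cases "(p', q') \<in> P")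
    case True
    then show ?thesis
      using insert.prems(2)[of p q p' q'] insert.hyps pq by auto
  next
    case False
    then show ?thesis
      using insert.prems(3)[of p q p' q'] that pq by auto
  qed
  then have "gaps g' (Suc k) = insert pq P \<union> gaps f n"
    using * k pq new by (auto simp: g'_def)
  moreover have "n \<le> Suc k" "\<forall>i<n. g' i = f i"
    using mg k by (auto simp: g'_def)
  ultimately show ?case by blast
qed

text \<open>The link between the coding and the topological argument. The prescription has to hold
  throughout an open set of parameters, because the useful parameters will only be known to be dense
  somewhere.\<close>

definition gaps_prescribable :: "(real \<Rightarrow> real set) \<Rightarrow> real set \<Rightarrow> real set \<Rightarrow> bool" where
  "gaps_prescribable C I U \<longleftrightarrow> (\<forall>P. finite P \<longrightarrow>
     (\<forall>(p, q)\<in>P. p \<in> \<rat> \<and> q \<in> \<rat> \<and> p < q \<and> {p..q} \<subseteq> U) \<longrightarrow>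
     pairwise (\<lambda>(p, q) (p', q'). {p..q} \<inter> {p'..q'} = {}) P \<longrightarrow>
     (\<exists>J. open J \<and> J \<noteq> {} \<and> J \<subseteq> I \<and>
        (\<forall>x\<in>J. \<forall>(p, q)\<in>P. p \<in> C x \<and> q \<in> C x \<and> C x \<inter> {p<..<q} = {})))"

text \<open>A dyadic interval around \<open>x\<close> inside \<open>I\<close> fixes only the first
  \<open>n\<close> digits, hence finitely many gaps. In a small ball avoiding their closures, the
  later digits can insert any finite family of rational gaps with disjoint closures.\<close>

lemma cantor_gaps_prescribable:
  assumes "open I" "x \<in> I" "open S" "cantor (bits x) \<inter> S \<noteq> {}"
  obtains z s where "s > 0" "ball z s \<subseteq> S" "gaps_prescribable (\<lambda>x. cantor (bits x)) I (ball z s)"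
proof -
  obtain n j where nj: "x \<in> dyadic n j" "dyadic n j \<subseteq> I"
    using dyadic_inside_open[OF assms(1,2)] .
  let ?f = "bits x"
  obtain w0 where w0: "w0 \<in> cantor ?f" "w0 \<in> S"
    using assms(4) by blast
  obtain z where z: "z \<in> S" "0 < z" "z < 1" "\<And>p q. (p, q) \<in> gaps ?f n \<Longrightarrow> z \<notin> {p..q}"
    using free_point[OF w0(1) assms(3) w0(2), of n] by blast
  define T where "T = S \<inter> {0<..<1} - (\<Union>(p, q)\<in>gaps ?f n. {p..q})"
  have "closed (\<Union>(p, q)\<in>gaps ?f n. {p..q})"
    by (rule closed_UN) (auto simp: finite_gaps)
  then have "open T"
    unfolding T_def using assms(3) by (intro open_Diff open_Int) auto
  moreover have "z \<in> T"
    unfolding T_def using z by auto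
  ultimately obtain s where s: "s > 0" "ball z s \<subseteq> T"
    using open_contains_ball by blast
  have "gaps_prescribable (\<lambda>x. cantor (bits x)) I (ball z s)"
    unfolding gaps_prescribable_def
  proof (intro allI impI)
    fix P :: "(real \<times> real) set"
    assume P: "finite P" and "\<forall>(p, q)\<in>P. p \<in> \<rat> \<and> q \<in> \<rat> \<and> p < q \<and> {p..q} \<subseteq> ball z s"
      and "pairwise (\<lambda>(p, q) (p', q'). {p..q} \<inter> {p'..q'} = {}) P"
    then have P': "\<And>p q. (p, q) \<in> P \<Longrightarrow> p \<in> \<rat> \<and> q \<in> \<rat> \<and> p < q \<and> {p..q} \<subseteq> ball z s"
      and P'': "\<And>p q p' q'. (p, q) \<in> P \<Longrightarrow> (p', q') \<in> P \<Longrightarrow> (p, q) \<noteq> (p', q') \<Longrightarrow> {p..q} \<inter> {p'..q'} = {}"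
      unfolding pairwise_def by fast+
    have disjoint: "q < p' \<or> q' < p" if "{p..q} \<inter> {p'..q'} = {}" "p < q" "p' < q'" for p q p' q' :: real
    proof (rule ccontr)
      assume "\<not> (q < p' \<or> q' < p)"
      then have "max p p' \<in> {p..q} \<inter> {p'..q'}"
        using that by auto
      then show False
        using that(1) by blast
    qed
    have P_T: "{p..q} \<subseteq> T" "p < q" if "(p, q) \<in> P" for p q
      using P'[OF that] s(2) by auto
    have "\<exists>m g. n \<le> m \<and> (\<forall>i<n. g i = ?f i) \<and> gaps g m = P \<union> gaps ?f n"
    proof (rule gaps_extend[OF P])
      show "p \<in> \<rat> \<and> q \<in> \<rat> \<and> 0 < p \<and> p < q \<and> q < 1" if "(p, q) \<in> P" for p q
      proof -
        have "p \<in> T" "q \<in> T" using P_T[OF that] by auto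
        then show ?thesis using P'[OF that] unfolding T_def by auto
      qed
      show "q < p' \<or> q' < p" if "(p, q) \<in> P" "(p', q') \<in> P" "(p, q) \<noteq> (p', q')" for p q p' q'
        using disjoint P''[OF that] P_T(2) that by blast
      show "q < p' \<or> q' < p" if pq: "(p, q) \<in> P" "(p', q') \<in> gaps ?f n" for p q p' q'
      proof (rule disjoint)
        have "{p'..q'} \<inter> T = {}"
          unfolding T_def using pq(2) by blast
        then show "{p..q} \<inter> {p'..q'} = {}"
          using P_T[OF pq(1)] by blast
      qed (use P_T[OF pq(1)] gaps_bounds[OF pq(2)] in auto)
    qed
    then obtain m g where mg: "n \<le> m" "\<forall>i<n. g i = ?f i" "gaps g m = P \<union> gaps ?f n"
      by blast
    \<comment> \<open>Digits below \<open>n\<close> come from the interval of \<open>x\<close>, the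
      next ones below \<open>m\<close> from \<open>g\<close>. Throughout the smaller interval the
      stage \<open>m\<close> gaps are therefore those of \<open>g\<close>.\<close>
    obtain j' where j': "dyadic m j' \<subseteq> {y \<in> dyadic n j. \<forall>k. n \<le> k \<and> k < m \<longrightarrow> bits y k = g k}"
      using dyadic_extend[OF mg(1)] by blast
    obtain a b where ab: "a < b" "{a<..<b} \<subseteq> dyadic m j'"
      using dyadic_contains_interval .
    have "p \<in> cantor (bits y) \<and> q \<in> cantor (bits y) \<and> cantor (bits y) \<inter> {p<..<q} = {}"
      if y: "y \<in> {a<..<b}" and pq: "(p, q) \<in> P" for y p q
    proof -
      have yd: "y \<in> dyadic n j" "\<And>k. n \<le> k \<Longrightarrow> k < m \<Longrightarrow> bits y k = g k"
        using subsetD[OF j' subsetD[OF ab(2) y]] by auto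
      have "gaps (bits y) m = gaps g m"
      proof (rule gaps_cong)
        fix i assume "i < m"
        then show "bits y i = g i"
          using yd bits_dyadic_cong[OF yd(1) nj(1), of i] mg(2) by (cases "i < n") auto
      qed
      then have "(p, q) \<in> gaps (bits y) m"
        using mg(3) pq by simp
      then show ?thesis
        using gap_endpoints_in_cantor cantor_gap by blast
    qed
    then have "\<forall>y\<in>{a<..<b}. \<forall>(p, q)\<in>P.
        p \<in> cantor (bits y) \<and> q \<in> cantor (bits y) \<and> cantor (bits y) \<inter> {p<..<q} = {}"
      by blast
    moreover have "{a<..<b} \<subseteq> I"
      using ab(2) j' nj(2) by blast
    moreover have "open {a<..<b}" "{a<..<b} \<noteq> {}"
      using ab(1) by simp_all
    ultimately show "\<exists>J. open J \<and> J \<noteq> {} \<and> J \<subseteq> I \<and> (\<forall>y\<in>J. \<forall>(p, q)\<in>P.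
        p \<in> cantor (bits y) \<and> q \<in> cantor (bits y) \<and> cantor (bits y) \<inter> {p<..<q} = {})"
      by (intro exI[of _ "{a<..<b}"] conjI)
  qed
  moreover have "ball z s \<subseteq> S"
    using s(2) unfolding T_def by auto
  ultimately show ?thesis
    using that s(1) by blast
qed

section \<open>The subspace of the product\<close>

text \<open>This counts the neighbourhoods of infinity in \<open>small_base\<close>. Sets of size
  \<open>n + 1\<close> arise from pairs of a point and a set of size \<open>n\<close>.\<close>

lemma card_of_finite_subsets_ordLeq:
  assumes "infinite A"
  shows "|{F. F \<subseteq> A \<and> finite F}| \<le>o |A|"
proof -
  have "|{F. F \<subseteq> A \<and> finite F \<and> card F = n}| \<le>o |A|" for n
  proof (induction n)
    case 0
    have "{F. F \<subseteq> A \<and> finite F \<and> card F = 0} = {{}}"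
      by auto
    moreover have "A \<noteq> {}"
      using assms by auto
    ultimately show ?case
      using card_of_singl_ordLeq by metis
  next
    case (Suc n)
    let ?S = "\<lambda>n. {F. F \<subseteq> A \<and> finite F \<and> card F = n}"
    have "?S (Suc n) \<subseteq> (\<lambda>(x, F). insert x F) ` (A \<times> ?S n)"
    proof
      fix F assume "F \<in> ?S (Suc n)"
      then have F: "F \<subseteq> A" "finite F" "card F = Suc n"
        by simp_all
      obtain x G where G: "F = insert x G" "card G = n"
        using F(3) unfolding card_Suc_eq by blast
      then have "(x, G) \<in> A \<times> ?S n"
        using F(1,2) by simp
      then show "F \<in> (\<lambda>(x, F). insert x F) ` (A \<times> ?S n)"
        by (rule rev_image_eqI) (simp add: G(1))
    qed
    then have "|?S (Suc n)| \<le>o |A \<times> ?S n|"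
      by (rule ordLeq_transitive[OF card_of_mono1 card_of_image])
    also have "|A \<times> ?S n| \<le>o |A|"
      using card_of_Times_ordLeq_infinite_Field[OF _ card_of_mono1[OF subset_refl] Suc card_of_Card_order] assms
      by (simp add: Field_card_of)
    finally show ?case .
  qed
  then have "|\<Union>n. {F. F \<subseteq> A \<and> finite F \<and> card F = n}| \<le>o |A|"
    using assms by (intro card_of_UNION_ordLeq_infinite) (simp_all add: infinite_iff_card_of_nat)
  moreover have "(\<Union>n. {F. F \<subseteq> A \<and> finite F \<and> card F = n}) = {F. F \<subseteq> A \<and> finite F}"
    by auto
  ultimately show ?thesis by simp
qed

text \<open>A comb with spine \<open>{0..1} \<times> {None}\<close> and a tooth \<open>C x\<close>
  over each isolated point \<open>Some (h x)\<close>, for \<open>x\<close> in \<open>A\<close>.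
  Nonempty teeth are what forces a base to be large.\<close>

locale comb =
  fixes A :: "real set" and h :: "real \<Rightarrow> 'd" and D :: "'d set" and C :: "real \<Rightarrow> real set"
  assumes inj: "inj_on h A" and hD: "h ` A \<subseteq> D"
    and closed_C: "closed (C x)" and C_unit: "C x \<subseteq> {0..1}" and C_nonempty: "C x \<noteq> {}"
begin

definition ambient :: "(real \<times> 'd option) topology" where
  "ambient = prod_topology (top_of_set {0..1}) (Alexandroff_compactification (discrete_topology D))"

definition fiber :: "real \<Rightarrow> (real \<times> 'd option) set" where
  "fiber x = C x \<times> {Some (h x)}"

definition carrier :: "(real \<times> 'd option) set" where
  "carrier = {0..1} \<times> {None} \<union> (\<Union>x\<in>A. fiber x)"

definition comb_top :: "(real \<times> 'd option) topology" where
  "comb_top = subtopology ambient carrier"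

lemma topspace_ambient: "topspace ambient = {0..1} \<times> insert None (Some ` D)"
  unfolding ambient_def by simp

lemma carrier_subset: "carrier \<subseteq> topspace ambient"
  unfolding carrier_def fiber_def topspace_ambient using C_unit hD by blast

lemma topspace_comb_top: "topspace comb_top = carrier"
  unfolding comb_top_def using carrier_subset by auto

lemma carrier_Some: "x \<in> A \<Longrightarrow> (y, Some (h x)) \<in> carrier \<longleftrightarrow> y \<in> C x"
  unfolding carrier_def fiber_def using inj by (auto dest: inj_onD)

lemma openin_box:
  assumes "open V" "openin (Alexandroff_compactification (discrete_topology D)) W"
  shows "openin ambient (({0..1} \<inter> V) \<times> W)"
  unfolding ambient_def openin_prod_Times_iff using assms by (auto simp: openin_open)

lemma openin_slice:
  assumes "open V" "openin (Alexandroff_compactification (discrete_topology D)) W"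
  shows "openin comb_top (carrier \<inter> V \<times> W)"
proof -
  have "carrier \<inter> V \<times> W = (({0..1} \<inter> V) \<times> W) \<inter> carrier"
    using carrier_subset unfolding topspace_ambient by auto
  then show ?thesis
    unfolding comb_top_def openin_subtopology using openin_box[OF assms] by auto
qed

lemma openin_strip: "open V \<Longrightarrow> openin comb_top (carrier \<inter> V \<times> UNIV)"
proof -
  assume "open V"
  have "openin (Alexandroff_compactification (discrete_topology D)) (insert None (Some ` D))"
    by (simp add: openin_Alexandroff_compactification_discrete)
  moreover have "carrier \<inter> V \<times> UNIV = carrier \<inter> V \<times> insert None (Some ` D)"
    using carrier_subset unfolding topspace_ambient by auto
  ultimately show ?thesis
    using openin_slice[OF \<open>open V\<close>] by simp
qed

lemma closedin_strip:
  assumes "closed V"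
  shows "closedin comb_top (carrier \<inter> V \<times> UNIV)"
proof -
  have "carrier - carrier \<inter> V \<times> UNIV = carrier \<inter> (- V) \<times> UNIV"
    by auto
  then show ?thesis
    unfolding closedin_def topspace_comb_top using openin_strip[of "- V"] assms
    by (simp add: open_Compl)
qed

lemma closedin_carrier: "closedin ambient carrier"
proof -
  \<comment> \<open>If \<open>d\<close> is not a value of \<open>h\<close> on \<open>A\<close>, the
    inner union is empty and the whole segment over \<open>d\<close> lies in the complement;
    otherwise injectivity makes it a single closed set.\<close>
  have "topspace ambient - carrier = (\<Union>d\<in>D. ({0..1} \<inter> - \<Union>{C x |x. x \<in> A \<and> h x = d}) \<times> {Some d})"
    unfolding topspace_ambient carrier_def fiber_def by auto
  moreover have "openin ambient (({0..1} \<inter> - \<Union>{C x |x. x \<in> A \<and> h x = d}) \<times> {Some d})"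
    if "d \<in> D" for d
  proof (rule openin_box)
    have "{C x |x. x \<in> A \<and> h x = d} \<subseteq> {C (inv_into A h d)}"
      using inj by auto
    then have "finite {C x |x. x \<in> A \<and> h x = d}"
      by (rule finite_subset) simp
    then have "closed (\<Union>{C x |x. x \<in> A \<and> h x = d})"
      by (rule closed_Union) (auto simp: closed_C)
    then show "open (- \<Union>{C x |x. x \<in> A \<and> h x = d})"
      by (rule open_Compl)
    show "openin (Alexandroff_compactification (discrete_topology D)) {Some d}"
      using that by (auto simp: openin_Alexandroff_compactification_discrete)
  qed
  ultimately show ?thesis
    unfolding closedin_def using carrier_subset by auto
qed

lemma compact_comb_top: "compact_space comb_top"
proof -
  have "compact_space ambient"
    unfolding ambient_def compact_space_prod_topology
    by (simp add: compact_space_subtopology)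
  then show ?thesis
    unfolding comb_top_def using closedin_carrier
    by (simp add: closedin_compact_space compact_space_subtopology)
qed

lemma fiber_eq_slice:
  assumes "x \<in> A"
  shows "fiber x = carrier \<inter> UNIV \<times> {Some (h x)}"
  using assms carrier_Some[OF assms] unfolding fiber_def by auto

lemma fiber_subset: "x \<in> A \<Longrightarrow> fiber x \<subseteq> carrier"
  unfolding carrier_def by auto

lemma openin_fiber:
  assumes "x \<in> A"
  shows "openin comb_top (fiber x)"
  unfolding fiber_eq_slice[OF assms]
  by (rule openin_slice) (use assms hD in \<open>auto simp: openin_Alexandroff_compactification_discrete\<close>)

lemma closedin_fiber:
  assumes "x \<in> A"
  shows "closedin comb_top (fiber x)"
proof -
  have "carrier - fiber x = carrier \<inter> UNIV \<times> (insert None (Some ` D) - {Some (h x)})"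
    unfolding fiber_eq_slice[OF assms] using carrier_subset unfolding topspace_ambient by auto
  moreover have "openin comb_top \<dots>"
  proof (rule openin_slice)
    have "insert None (Some ` D) - (insert None (Some ` D) - {Some (h x)}) \<subseteq> {Some (h x)}"
      by auto
    then show "openin (Alexandroff_compactification (discrete_topology D)) (insert None (Some ` D) - {Some (h x)})"
      unfolding openin_Alexandroff_compactification_discrete by (auto intro: finite_subset)
  qed simp
  ultimately show ?thesis
    unfolding closedin_def topspace_comb_top using fiber_subset[OF assms] by simp
qed

lemma closed_section:
  assumes "closedin comb_top L" "closed S" "S \<times> {a} \<subseteq> carrier"
  shows "closed {y \<in> S. (y, a) \<in> L}"
\<comment> \<open>For empty \<open>S\<close> nothing forces \<open>a\<close> into the
  compactification; otherwise the section is a preimage under the embedding of \<open>S\<close> at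
  height \<open>a\<close>.\<close>
proof (cases "S = {}")
  case False
  then have "a \<in> insert None (Some ` D)" "S \<subseteq> {0..1}"
    using assms(3) carrier_subset unfolding topspace_ambient by auto
  then have "continuous_map (top_of_set S) comb_top (\<lambda>y. (y, a))"
    unfolding comb_top_def continuous_map_in_subtopology ambient_def continuous_map_pairwise
    using assms(3) by (auto simp: continuous_map_in_subtopology o_def)
  from closedin_continuous_map_preimage[OF this assms(1)]
  show ?thesis
    using assms(2) closedin_closed_trans by auto
qed simp

text \<open>The part of \<open>L\<close> over \<open>V\<close> is compact and misses the spine, so
  the open fibers cover it, and finitely many of them suffice.\<close>

lemma finite_fibers_meeting:
  assumes "closedin comb_top L" "closed V" "\<And>y. y \<in> V \<Longrightarrow> (y, None) \<notin> L"
  shows "finite {x \<in> A. \<exists>y\<in>V. (y, Some (h x)) \<in> L}"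
proof -
  let ?S = "L \<inter> (carrier \<inter> V \<times> UNIV)"
  have L: "L \<subseteq> carrier"
    using closedin_subset[OF assms(1)] topspace_comb_top by simp
  have "compactin comb_top ?S"
    by (intro closedin_compact_space[OF compact_comb_top] closedin_Int[OF assms(1) closedin_strip[OF assms(2)]])
  moreover have "?S \<subseteq> \<Union>(fiber ` A)"
    using assms(3) unfolding carrier_def by auto
  ultimately obtain \<F> where F: "finite \<F>" "\<F> \<subseteq> fiber ` A" "?S \<subseteq> \<Union>\<F>"
    using compactinD[of comb_top ?S "fiber ` A"] openin_fiber by auto
  then obtain B where B: "finite B" "B \<subseteq> A" "\<F> = fiber ` B"
    by (meson finite_subset_image)
  have "{x \<in> A. \<exists>y\<in>V. (y, Some (h x)) \<in> L} \<subseteq> B"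
  proof
    fix x assume "x \<in> {x \<in> A. \<exists>y\<in>V. (y, Some (h x)) \<in> L}"
    then obtain y where x: "x \<in> A" "(y, Some (h x)) \<in> ?S"
      using L by auto
    then obtain x' where "x' \<in> B" "h x = h x'"
      using F(3) B(3) unfolding fiber_def by auto
    then show "x \<in> B"
      using inj x(1) B(2) by (metis inj_onD subsetD)
  qed
  then show ?thesis
    using B(1) finite_subset by blast
qed

section \<open>Weight of the comb\<close>

lemma card_of_base_ge:
  assumes "is_base comb_top \<B>"
  shows "|A| \<le>o |\<B>|"
proof -
  \<comment> \<open>Each fiber is open and nonempty, so it contains a nonempty base member. As the
    fibers are disjoint, the choice of such members is injective.\<close>
  have "\<exists>U\<in>\<B>. U \<noteq> {} \<and> U \<subseteq> fiber x" if x: "x \<in> A" for x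
  proof -
    obtain z where "z \<in> fiber x"
      using C_nonempty[of x] unfolding fiber_def by auto
    then have "\<exists>U. U \<in> \<B> \<and> z \<in> U \<and> U \<subseteq> fiber x"
      using assms openin_fiber[OF x] unfolding is_base_def openin_topology_base_unique by (cases z) blast
    then show ?thesis
      by auto
  qed
  then obtain f where f: "\<And>x. x \<in> A \<Longrightarrow> f x \<in> \<B> \<and> f x \<noteq> {} \<and> f x \<subseteq> fiber x"
    by metis
  have "inj_on f A"
  proof (rule inj_onI)
    fix x y assume xy: "x \<in> A" "y \<in> A" "f x = f y"
    then have "fiber x \<inter> fiber y \<noteq> {}"
      using f[of x] f[of y] by auto
    then show "x = y"
      using xy inj unfolding fiber_def by (auto dest: inj_onD)
  qed
  then show ?thesis
    using f by (intro card_of_ordLeqI[of f]) auto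
qed

lemma small_base:
  assumes "infinite A"
  obtains \<B> where "is_base comb_top \<B>" "|\<B>| \<le>o |A|"
proof -
  obtain G :: "real set set" where G: "countable G" "topological_basis G"
    using ex_countable_basis by blast
  \<comment> \<open>Neighbourhoods of infinity exclude only points \<open>Some (h x)\<close> with
    \<open>x\<close> in \<open>A\<close>, since the carrier has no points over the rest of
    \<open>D\<close>. This keeps the count at the cardinality of \<open>A\<close> even when
    \<open>D\<close> is larger.\<close>
  define \<W> where "\<W> = (\<lambda>x. {Some (h x)}) ` A \<union>
    (\<lambda>F. insert None (Some ` D) - Some ` h ` F) ` {F. F \<subseteq> A \<and> finite F}"
  define \<B> where "\<B> = (\<lambda>(V, W). carrier \<inter> V \<times> W) ` (G \<times> \<W>)"
  have open_W: "openin (Alexandroff_compactification (discrete_topology D)) W" if W: "W \<in> \<W>" for W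
  proof -
    have "finite (insert None (Some ` D) - (insert None (Some ` D) - Some ` h ` F))" if "finite F" for F
      by (rule finite_subset[of _ "Some ` h ` F"]) (use that in auto)
    then show ?thesis
      using W hD unfolding openin_Alexandroff_compactification_discrete \<W>_def by auto
  qed
  have "is_base comb_top \<B>"
    unfolding is_base_def openin_topology_base_unique
  proof (intro conjI allI impI)
    fix U assume "U \<in> \<B>"
    then show "openin comb_top U"
      unfolding \<B>_def using open_W topological_basis_open[OF G(2)] by (auto intro!: openin_slice)
  next
    fix U z assume Uz: "openin comb_top U \<and> z \<in> U"
    obtain y a where z: "z = (y, a)"
      by (cases z)
    obtain U' where U': "openin ambient U'" "U = U' \<inter> carrier"
      using Uz unfolding comb_top_def openin_subtopology by auto
    then obtain V0 W0 where VW: "openin (top_of_set {0..1}) V0"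
        "openin (Alexandroff_compactification (discrete_topology D)) W0"
        "y \<in> V0" "a \<in> W0" "V0 \<times> W0 \<subseteq> U'"
      using U'(1)[unfolded ambient_def openin_prod_topology_alt, rule_format, of y a] Uz U'(2) z
      by auto
    then obtain V1 where V1: "open V1" "V0 = {0..1} \<inter> V1"
      by (auto simp: openin_open)
    then obtain V where V: "V \<in> G" "y \<in> V" "V \<subseteq> V1"
      using topological_basisE[OF G(2)] VW(3) by blast
    \<comment> \<open>The inclusion in \<open>W0\<close> is asked for on the carrier only, so
      \<open>W\<close> may contain further points of the compactification.\<close>
    have "\<exists>W\<in>\<W>. a \<in> W \<and> carrier \<inter> UNIV \<times> W \<subseteq> UNIV \<times> W0"
    proof (cases a)
      case None
      define F where "F = {x \<in> A. Some (h x) \<notin> W0}"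
      have fin: "finite (insert None (Some ` D) - W0)"
        using VW(2,4) None by (simp add: openin_Alexandroff_compactification_discrete)
      have "(\<lambda>x. Some (h x)) ` F \<subseteq> insert None (Some ` D) - W0"
        using hD unfolding F_def by auto
      then have "finite ((\<lambda>x. Some (h x)) ` F)"
        using fin finite_subset by blast
      moreover have "inj_on (\<lambda>x. Some (h x)) F"
        using inj unfolding F_def by (auto simp: inj_on_def)
      ultimately have "finite F"
        by (rule finite_imageD)
      have "F \<subseteq> A"
        unfolding F_def by auto
      define W where "W = insert None (Some ` D) - Some ` h ` F"
      have "W \<in> \<W>"
        unfolding \<W>_def W_def using \<open>finite F\<close> \<open>F \<subseteq> A\<close> by blast
      moreover have "a \<in> W"
        unfolding W_def None by simp
      moreover have "carrier \<inter> UNIV \<times> W \<subseteq> UNIV \<times> W0"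
        using VW(4) None unfolding carrier_def fiber_def F_def W_def by auto
      ultimately show ?thesis
        by (intro bexI[of _ W] conjI)
    next
      case (Some d)
      then obtain x where "x \<in> A" "d = h x"
        using Uz U' z unfolding carrier_def fiber_def by auto
      then have "{a} \<in> \<W>"
        unfolding \<W>_def Some by auto
      then show ?thesis
        using VW(4) by (intro bexI[of _ "{a}"]) auto
    qed
    then obtain W where W: "W \<in> \<W>" "a \<in> W" "carrier \<inter> UNIV \<times> W \<subseteq> UNIV \<times> W0"
      by blast
    have "carrier \<inter> V \<times> W \<in> \<B>"
      unfolding \<B>_def using V W by auto
    moreover have "z \<in> carrier \<inter> V \<times> W"
      using z Uz U' V W by auto
    moreover have "carrier \<inter> V \<times> W \<subseteq> U"
    proof -
      have "carrier \<inter> V \<times> W \<subseteq> V0 \<times> W0"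
        using W(3) V(3) V1(2) carrier_subset unfolding topspace_ambient by auto
      then show ?thesis
        using VW(5) U'(2) by blast
    qed
    ultimately show "\<exists>V. V \<in> \<B> \<and> z \<in> V \<and> V \<subseteq> U"
      by blast
  qed
  moreover have "|\<B>| \<le>o |A|"
  proof -
    have field: "infinite (Field |A| )" "Card_order |A|"
      using assms by (simp add: Field_card_of) (rule card_of_Card_order)
    have "|G| \<le>o |UNIV :: nat set|"
      using G(1) unfolding countable_def by (meson card_of_ordLeq top_greatest)
    also have "|UNIV :: nat set| \<le>o |A|"
      using assms infinite_iff_card_of_nat by blast
    finally have "|G| \<le>o |A|" .
    moreover have "|\<W>| \<le>o |A|"
      unfolding \<W>_def
      by (intro card_of_Un_ordLeq_infinite_Field field card_of_image
          ordLeq_transitive[OF card_of_image card_of_finite_subsets_ordLeq[OF assms]])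
    ultimately have "|G \<times> \<W>| \<le>o |A|"
      by (intro card_of_Times_ordLeq_infinite_Field field)
    then show ?thesis
      unfolding \<B>_def using card_of_image ordLeq_transitive by blast
  qed
  ultimately show ?thesis
    using that by blast
qed

lemma weight_comb_top:
  assumes "infinite A"
  shows "weight comb_top =o |A|"
proof -
  obtain \<B> where B: "is_base comb_top \<B>" "|\<B>| \<le>o |A|"
    using small_base[OF assms] by blast
  obtain \<B>' where B': "is_base comb_top \<B>'" "weight comb_top = |\<B>'|" "\<And>\<B>. is_base comb_top \<B> \<Longrightarrow> |\<B>'| \<le>o |\<B>|"
    using least_cardinality[of "is_base comb_top", OF B(1)] unfolding weight_def by metis
  have "|\<B>'| \<le>o |A|"
    using B'(3)[OF B(1)] B(2) ordLeq_transitive by blast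
  then show ?thesis
    using card_of_base_ge[OF B'(1)] unfolding B'(2) ordIso_iff_ordLeq by blast
qed

end

section \<open>Failure of supercompactness\<close>

lemma finite_separated_balls:
  fixes E :: "real set"
  assumes "finite E" "E \<subseteq> S" "open S"
  obtains r where "r > 0" "\<And>e. e \<in> E \<Longrightarrow> cball e r \<subseteq> S"
    "\<And>e e'. e \<in> E \<Longrightarrow> e' \<in> E \<Longrightarrow> e \<noteq> e' \<Longrightarrow> cball e r \<inter> cball e' r = {}"
proof -
  have "\<exists>r>0. cball e r \<subseteq> S \<and> (\<forall>e'\<in>E. e \<noteq> e' \<longrightarrow> 2 * r < dist e e')" if "e \<in> E" for e
  proof -
    have "e \<in> S"
      using assms(2) that by auto
    then obtain r1 where r1: "r1 > 0" "cball e r1 \<subseteq> S"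
      using open_contains_cball_eq[OF assms(3)] by auto
    obtain r2 where r2: "r2 > 0" "\<forall>e'\<in>E. e' \<noteq> e \<longrightarrow> r2 \<le> dist e e'"
      using finite_set_avoid[OF assms(1)] by blast
    have "cball e (min r1 (r2/3)) \<subseteq> S"
      using r1(2) by auto
    moreover have "2 * min r1 (r2/3) < dist e e'" if "e' \<in> E" "e \<noteq> e'" for e'
    proof -
      have "r2 \<le> dist e e'" using r2(2) that by auto
      then show ?thesis using r2(1) by linarith
    qed
    ultimately show ?thesis
      using r1(1) r2(1) by (intro exI[of _ "min r1 (r2/3)"]) auto
  qed
  then obtain \<rho> where \<rho>: "\<And>e. e \<in> E \<Longrightarrow> \<rho> e > 0 \<and> cball e (\<rho> e) \<subseteq> S \<and> (\<forall>e'\<in>E. e \<noteq> e' \<longrightarrow> 2 * \<rho> e < dist e e')"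
    by metis
  \<comment> \<open>The inserted 1 keeps the minimum defined for empty \<open>E\<close>.\<close>
  define r where "r = Min (insert 1 (\<rho> ` E))"
  have le: "r \<le> \<rho> e" if "e \<in> E" for e
    unfolding r_def using assms(1) that by (intro Min_le) auto
  show ?thesis
  proof (rule that[of r])
    show "r > 0"
      unfolding r_def using assms(1) \<rho> by (subst Min_gr_iff) auto
    show "cball e r \<subseteq> S" if "e \<in> E" for e
      using \<rho>[OF that] le[OF that] subset_cball by blast
    show "cball e r \<inter> cball e' r = {}" if e: "e \<in> E" "e' \<in> E" "e \<noteq> e'" for e e'
    proof -
      have "2 * r < dist e e'"
        using \<rho>[OF e(1)] le[OF e(1)] e by force
      moreover have "dist e e' \<le> dist e y + dist e' y" for y
        by (rule dist_triangle2)
      ultimately have "\<not> (dist e y \<le> r \<and> dist e' y \<le> r)" for y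
        by (smt (verit))
      then show ?thesis
        by auto
    qed
  qed
qed

context comb
begin

lemma not_supercompact:
  assumes nm: "\<not> meager A"
    and pattern: "\<And>I x S. open I \<Longrightarrow> x \<in> I \<Longrightarrow> open S \<Longrightarrow> C x \<inter> S \<noteq> {} \<Longrightarrow>
      \<exists>z s. s > 0 \<and> ball z s \<subseteq> S \<and> gaps_prescribable C I (ball z s)"
  shows "\<not> supercompact comb_top"
proof
  assume "supercompact comb_top"
  then obtain \<B> where sub: "is_subbase comb_top \<B>"
    and bin: "\<And>\<C>. \<C> \<subseteq> \<B> \<Longrightarrow> topspace comb_top \<subseteq> \<Union>\<C> \<Longrightarrow>
      \<exists>\<D>\<subseteq>\<C>. finite \<D> \<and> card \<D> \<le> 2 \<and> topspace comb_top \<subseteq> \<Union>\<D>"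
    unfolding supercompact_def by auto
  let ?K = "kset comb_top \<B>"
  note closed_K = closedin_kset[OF sub]
  note sandwich = kset_sandwich[OF compact_comb_top sub]
  obtain G :: "real set set" where G: "countable G" "topological_basis G"
    using ex_countable_basis by blast
  \<comment> \<open>With \<open>S\<close> ranging over a countable base, countably many sets
    \<open>Good S\<close> will cover \<open>A\<close>.\<close>
  define Good where "Good S = {x. C x \<inter> S \<noteq> {} \<and>
      (\<exists>M. ?K M \<and> M \<subseteq> fiber x \<and> (C x \<inter> S) \<times> {Some (h x)} \<subseteq> M)}" for S
  have "A \<subseteq> (\<Union>S\<in>G. Good S)"
  proof
    fix x assume x: "x \<in> A"
    obtain \<F> where F: "finite \<F>" "\<And>M. M \<in> \<F> \<Longrightarrow> ?K M" "fiber x \<subseteq> \<Union>\<F>" "\<Union>\<F> \<subseteq> fiber x"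
      using sandwich[OF closedin_fiber[OF x] openin_fiber[OF x] subset_refl] by blast
    \<comment> \<open>The sections of the finitely many \<open>M\<close> form a closed cover of
      \<open>C x\<close>, so one of them contains a nonempty relatively open piece.\<close>
    define f where "f M = {y \<in> C x. (y, Some (h x)) \<in> M}" for M
    have "closed (f M)" if "M \<in> \<F>" for M
      unfolding f_def using fiber_subset[OF x] F(2)[OF that]
      by (intro closed_section closed_K closed_C) (auto simp: fiber_def)
    moreover have "C x \<subseteq> (\<Union>M\<in>\<F>. f M)"
      using F(3) unfolding fiber_def f_def by auto
    ultimately obtain M S where M: "M \<in> \<F>" "open S" "C x \<inter> S \<noteq> {}" "C x \<inter> S \<subseteq> f M"
      using finite_closed_cover_open_piece[OF F(1), of f "C x"] C_nonempty[of x] by auto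
    then obtain y where y: "y \<in> C x" "y \<in> S"
      by auto
    obtain S' where S': "S' \<in> G" "y \<in> S'" "S' \<subseteq> S"
      using topological_basisE[OF G(2) M(2) y(2)] .
    have "(C x \<inter> S') \<times> {Some (h x)} \<subseteq> M"
      using M(4) S'(3) unfolding f_def by auto
    moreover have "?K M" "M \<subseteq> fiber x"
      using F M(1) by auto
    ultimately have "x \<in> Good S'"
      unfolding Good_def using y(1) S'(2) by auto
    then show "x \<in> (\<Union>S\<in>G. Good S)"
      using S'(1) by auto
  qed
  then obtain S where S: "S \<in> G" "interior (closure (A \<inter> Good S)) \<noteq> {}"
    using not_meager_dense_piece[OF nm G(1)] by metis
  define I where "I = interior (closure (A \<inter> Good S))"
  \<comment> \<open>Deleting finitely many reals from a nonempty open \<open>J\<close> leaves a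
    nonempty open set, which the dense set still meets. Infinitely many points are needed because
    finitely many parameters are discarded later.\<close>
  have dense: "infinite (J \<inter> (A \<inter> Good S))" if "open J" "J \<noteq> {}" "J \<subseteq> I" for J
  proof
    assume fin: "finite (J \<inter> (A \<inter> Good S))"
    define J' where "J' = J - J \<inter> (A \<inter> Good S)"
    have "open J'"
      unfolding J'_def using that(1) fin by (intro open_Diff finite_imp_closed)
    moreover have "J' \<noteq> {}"
    proof
      assume "J' = {}"
      then have "finite J"
        using fin unfolding J'_def by (metis Diff_eq_empty_iff finite_subset)
      then show False
        using finite_imp_not_open that by blast
    qed
    moreover have "J' \<subseteq> closure (A \<inter> Good S)"
      using that(3) interior_subset unfolding J'_def I_def by blast
    ultimately have "J' \<inter> (A \<inter> Good S) \<noteq> {}"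
      using open_Int_closure_eq_empty by blast
    then show False
      unfolding J'_def by auto
  qed
  have "open I" "I \<noteq> {}"
    unfolding I_def using S(2) by auto
  then have "I \<inter> (A \<inter> Good S) \<noteq> {}"
    using dense[of I] by (metis finite.emptyI order_refl)
  then obtain x0 where x0: "x0 \<in> I" "x0 \<in> A" "x0 \<in> Good S"
    by auto
  have "open S"
    using S(1) G(2) topological_basis_open by blast
  have "C x0 \<inter> S \<noteq> {}"
    using x0(3) unfolding Good_def by simp
  from pattern[OF \<open>open I\<close> x0(1) \<open>open S\<close> this]
  obtain z s where zs: "s > 0" "ball z s \<subseteq> S" and pat: "gaps_prescribable C I (ball z s)"
    by auto
  have cover: "\<exists>\<F>. finite \<F> \<and> (\<forall>L\<in>\<F>. ?K L) \<and> carrier \<inter> cball e (\<rho>/2) \<times> UNIV \<subseteq> \<Union>\<F> \<and>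
      \<Union>\<F> \<subseteq> carrier \<inter> ball e \<rho> \<times> UNIV" if "\<rho> > 0" for e \<rho> :: real
  proof -
    have "cball e (\<rho>/2) \<subseteq> ball e \<rho>"
      using that by auto
    then have "carrier \<inter> cball e (\<rho>/2) \<times> UNIV \<subseteq> carrier \<inter> ball e \<rho> \<times> UNIV"
      by auto
    with sandwich[OF closedin_strip[OF closed_cball] openin_strip[OF open_ball]]
    show ?thesis
      by metis
  qed
  define sec where "sec L = {y \<in> {0..1}. (y, None) \<in> L}" for L :: "(real \<times> 'd option) set"
  have compact_sec: "compact (sec L)" if "?K L" for L
  proof -
    have "closed (sec L)"
      unfolding sec_def by (rule closed_section[OF closed_K[OF that]]) (auto simp: carrier_def)
    moreover have "bounded (sec L)"
      unfolding sec_def by (rule bounded_subset[OF bounded_closed_interval[of 0 1]]) auto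
    ultimately show ?thesis
      using compact_eq_bounded_closed by blast
  qed
  obtain \<G> where \<G>: "finite \<G>" "\<And>L. L \<in> \<G> \<Longrightarrow> ?K L" "carrier \<inter> cball z (s/2) \<times> UNIV \<subseteq> \<Union>\<G>"
      "\<Union>\<G> \<subseteq> carrier \<inter> ball z s \<times> UNIV"
    using cover[OF zs(1), of z] by auto
  have "\<exists>m\<in>sec L. \<forall>y\<in>sec L. y \<le> m" if "?K L" "sec L \<noteq> {}" for L
    using compact_attains_sup[OF compact_sec that(2)] that(1) by blast
  then obtain top where top: "\<And>L. ?K L \<Longrightarrow> sec L \<noteq> {} \<Longrightarrow> top L \<in> sec L \<and> (\<forall>y\<in>sec L. y \<le> top L)"
    by metis
  \<comment> \<open>\<open>z\<close> is added so that a prescribed gap ends at \<open>q z\<close>: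
    over this point the set \<open>L\<close> is picked at the end.\<close>
  define E where "E = insert z (top ` {L \<in> \<G>. sec L \<noteq> {}})"
  have "finite E"
    unfolding E_def using \<G>(1) by simp
  have "E \<subseteq> ball z s"
  proof -
    have "top L \<in> ball z s" if "L \<in> \<G>" "sec L \<noteq> {}" for L
    proof -
      have "(top L, None) \<in> L"
        using top[OF \<G>(2)[OF that(1)] that(2)] unfolding sec_def by simp
      then show ?thesis
        using \<G>(4) that(1) by blast
    qed
    then have "top ` {L \<in> \<G>. sec L \<noteq> {}} \<subseteq> ball z s"
      by blast
    then show ?thesis
      unfolding E_def using zs(1) by simp
  qed
  obtain r where r: "r > 0" "\<And>e. e \<in> E \<Longrightarrow> cball e r \<subseteq> ball z s"
    "\<And>e e'. e \<in> E \<Longrightarrow> e' \<in> E \<Longrightarrow> e \<noteq> e' \<Longrightarrow> cball e r \<inter> cball e' r = {}"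
    by (rule finite_separated_balls[OF \<open>finite E\<close> \<open>E \<subseteq> ball z s\<close> open_ball]) (rule that)
  \<comment> \<open>As \<open>p\<close> lies left of \<open>e - r/2\<close>, no set of the cover
    reaches past the left end of the gap. The upper bounds keep \<open>q\<close> in the region that
    is covered, for \<open>e = z\<close> also by the first cover. The last clause holds because
    \<open>q\<close> is taken from an open set around \<open>e\<close> that misses every section
    omitting \<open>e\<close>.\<close>
  have "\<exists>\<F> p q. finite \<F> \<and> (\<forall>L\<in>\<F>. ?K L) \<and> carrier \<inter> cball e (r/4) \<times> UNIV \<subseteq> \<Union>\<F> \<and>
      \<Union>\<F> \<subseteq> carrier \<inter> ball e (r/2) \<times> UNIV \<and> p \<in> \<rat> \<and> q \<in> \<rat> \<and> e - r < p \<and> p < e - r/2 \<and>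
      e < q \<and> q < e + r/4 \<and> q < e + s/2 \<and> (\<forall>L\<in>\<F>. q \<in> sec L \<longrightarrow> e \<in> sec L)" for e
  proof -
    obtain \<F> where F: "finite \<F>" "\<forall>L\<in>\<F>. ?K L" "carrier \<inter> cball e (r/4) \<times> UNIV \<subseteq> \<Union>\<F>"
        "\<Union>\<F> \<subseteq> carrier \<inter> ball e (r/2) \<times> UNIV"
      using cover[of "r/2" e] r(1) by auto
    define U where "U = - (\<Union>L\<in>{L \<in> \<F>. e \<notin> sec L}. sec L)"
    have "open U"
      unfolding U_def using F(1,2) compact_sec compact_imp_closed
      by (intro open_Compl closed_UN) auto
    moreover have "e \<in> U"
      unfolding U_def by auto
    ultimately obtain t where t: "t > 0" "ball e t \<subseteq> U"
      using open_contains_ball by blast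
    obtain p where p: "p \<in> \<rat>" "e - r < p" "p < e - r/2"
      using Rats_dense_in_real[of "e - r" "e - r/2"] r(1) by auto
    obtain q where q: "q \<in> \<rat>" "e < q" "q < e + min t (min (r/4) (s/2))"
      using Rats_dense_in_real[of e "e + min t (min (r/4) (s/2))"] r(1) zs(1) t(1) by auto
    have "q \<in> U"
      using q t(2) by (auto simp: dist_real_def subset_eq)
    then have "\<forall>L\<in>\<F>. q \<in> sec L \<longrightarrow> e \<in> sec L"
      unfolding U_def by auto
    then show ?thesis
      using F p q by (intro exI[of _ \<F>] exI[of _ p] exI[of _ q]) auto
  qed
  then obtain H p q where H: "\<And>e. finite (H e)" "\<And>e L. L \<in> H e \<Longrightarrow> ?K L"
      "\<And>e. carrier \<inter> cball e (r/4) \<times> UNIV \<subseteq> \<Union>(H e)" "\<And>e. \<Union>(H e) \<subseteq> carrier \<inter> ball e (r/2) \<times> UNIV"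
    and pq: "\<And>e. p e \<in> \<rat>" "\<And>e. q e \<in> \<rat>" "\<And>e. e - r < p e" "\<And>e. p e < e - r/2"
      "\<And>e. e < q e" "\<And>e. q e < e + r/4" "\<And>e. q e < e + s/2"
    and Hq: "\<And>e L. L \<in> H e \<Longrightarrow> q e \<in> sec L \<Longrightarrow> e \<in> sec L"
    by metis
  have pq_cball: "{p e..q e} \<subseteq> cball e r" for e
    using pq(3-6)[of e] r(1) by (auto simp: dist_real_def)
  define P where "P = (\<lambda>e. (p e, q e)) ` E"
  have "finite P"
    unfolding P_def using \<open>finite E\<close> by simp
  moreover have "\<forall>(p, q)\<in>P. p \<in> \<rat> \<and> q \<in> \<rat> \<and> p < q \<and> {p..q} \<subseteq> ball z s"
  proof -
    have "p e < q e" "{p e..q e} \<subseteq> ball z s" if "e \<in> E" for e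
      using pq(4,5)[of e] r(1) pq_cball[of e] r(2)[OF that] by auto
    then show ?thesis
      unfolding P_def using pq(1,2) by auto
  qed
  moreover have "pairwise (\<lambda>(p, q) (p', q'). {p..q} \<inter> {p'..q'} = {}) P"
    unfolding P_def pairwise_image
  proof (rule pairwiseI)
    fix e e' assume e: "e \<in> E" "e' \<in> E" "e \<noteq> e'"
    then have "{p e..q e} \<inter> {p e'..q e'} = {}"
      using pq_cball[of e] pq_cball[of e'] r(3)[OF e] by blast
    then show "(p e, q e) \<noteq> (p e', q e') \<longrightarrow> (case (p e, q e) of (p, q) \<Rightarrow> \<lambda>(p', q'). {p..q} \<inter> {p'..q'} = {}) (p e', q e')"
      by simp
  qed
  ultimately have "\<exists>J. open J \<and> J \<noteq> {} \<and> J \<subseteq> I \<and>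
      (\<forall>x\<in>J. \<forall>(p, q)\<in>P. p \<in> C x \<and> q \<in> C x \<and> C x \<inter> {p<..<q} = {})"
    using pat unfolding gaps_prescribable_def by simp
  then obtain J where J: "open J" "J \<noteq> {}" "J \<subseteq> I"
    and "\<forall>x\<in>J. \<forall>(p, q)\<in>P. p \<in> C x \<and> q \<in> C x \<and> C x \<inter> {p<..<q} = {}"
    by (elim exE conjE)
  then have JC: "p e \<in> C x \<and> q e \<in> C x \<and> C x \<inter> {p e<..<q e} = {}" if "x \<in> J" "e \<in> E" for x e
    using that unfolding P_def by simp
  define meet where "meet L V = {x \<in> A. \<exists>y\<in>V. (y, Some (h x)) \<in> L}"
    for L :: "(real \<times> 'd option) set" and V
  have fin_meet: "finite (meet L V)" if "?K L" "closed V" "V \<inter> sec L = {}" "V \<subseteq> {0..1}" for L V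
    unfolding meet_def
  proof (rule finite_fibers_meeting[OF closed_K[OF that(1)] that(2)])
    fix y assume "y \<in> V"
    then have "y \<notin> sec L" "y \<in> {0..1}"
      using that(3,4) by blast+
    then show "(y, None) \<notin> L"
      unfolding sec_def by simp
  qed
  txt \<open>The finitely many exceptional fibers, where closed sets are not controlled by their sections at infinity.\<close>
  define X1 where "X1 = (\<Union>L\<in>{L \<in> \<G>. sec L = {}}. meet L {0..1})"
  define X2 where "X2 = (\<Union>L\<in>{L \<in> \<G>. sec L \<noteq> {}}. meet L ({q (top L)..} \<inter> {0..1}))"
  define X3 where "X3 = (\<Union>e\<in>E. \<Union>L\<in>{L \<in> H e. q e \<notin> sec L}. meet L ({q e} \<inter> {0..1}))"
  have "finite X1"
    unfolding X1_def using \<G>(1,2) by (auto intro!: finite_UN_I fin_meet)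
  moreover have "finite X2"
  proof -
    \<comment> \<open>\<open>top L\<close> is the largest point of the section, and its
      \<open>q\<close> lies strictly to the right of it.\<close>
    have "({q (top L)..} \<inter> {0..1}) \<inter> sec L = {}" if "L \<in> \<G>" "sec L \<noteq> {}" for L
      using top[OF \<G>(2)[OF that(1)] that(2)] pq(5)[of "top L"] by fastforce
    then show ?thesis
      unfolding X2_def using \<G>(1,2) by (intro finite_UN_I fin_meet) auto
  qed
  moreover have "finite X3"
    unfolding X3_def using \<open>finite E\<close> H(1,2) by (intro finite_UN_I fin_meet) auto
  ultimately have "finite (X1 \<union> X2 \<union> X3)"
    by simp
  then have "infinite (J \<inter> (A \<inter> Good S) - (X1 \<union> X2 \<union> X3))"
    using dense[OF J] by (rule Diff_infinite_finite)
  then obtain x where "x \<in> J \<inter> (A \<inter> Good S) - (X1 \<union> X2 \<union> X3)"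
    using infinite_imp_nonempty by blast
  then have x: "x \<in> J" "x \<in> A" "x \<in> Good S" "x \<notin> X1" "x \<notin> X2" "x \<notin> X3"
    by simp_all
  obtain M where M: "?K M" "M \<subseteq> fiber x" "(C x \<inter> S) \<times> {Some (h x)} \<subseteq> M"
    using x(3) unfolding Good_def by blast
  have q_carrier: "q e \<in> C x" "(q e, Some (h x)) \<in> carrier" "(q e, Some (h x)) \<in> M" if e: "e \<in> E" for e
  proof -
    show *: "q e \<in> C x"
      using JC[OF x(1) e] by simp
    then show "(q e, Some (h x)) \<in> carrier"
      using carrier_Some[OF x(2)] by simp
    have "q e \<in> cball e r"
      using pq(5,6)[of e] r(1) by (auto simp: dist_real_def)
    then have "q e \<in> S"
      using r(2)[OF e] zs(2) by auto
    then show "(q e, Some (h x)) \<in> M"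
      using * M(3) by auto
  qed
  have "z \<in> E"
    unfolding E_def by simp
  have "q z \<in> cball z (s/2)"
    using pq(5,7)[of z] by (auto simp: dist_real_def)
  then obtain L where L: "L \<in> \<G>" "(q z, Some (h x)) \<in> L"
    using q_carrier(2)[OF \<open>z \<in> E\<close>] \<G>(3) by blast
  have "sec L \<noteq> {}"
  proof
    assume "sec L = {}"
    moreover have "q z \<in> {0..1}"
      using q_carrier(1)[OF \<open>z \<in> E\<close>] C_unit by blast
    ultimately have "x \<in> X1"
      unfolding X1_def meet_def using L x(2) by blast
    then show False
      using x(4) by simp
  qed
  define e where "e = top L"
  have e: "e \<in> E" "(e, None) \<in> L"
    using L(1) \<open>sec L \<noteq> {}\<close> top[OF \<G>(2)[OF L(1)]] unfolding e_def E_def sec_def by auto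
  have "q e \<in> cball e (r/4)"
    using pq(5,6)[of e] by (auto simp: dist_real_def)
  then obtain L' where L': "L' \<in> H e" "(q e, Some (h x)) \<in> L'"
    using q_carrier(2)[OF e(1)] H(3) by blast
  \<comment> \<open>Otherwise \<open>L'\<close> would meet the fiber over \<open>q e\<close> without
    containing the point at infinity there, which puts \<open>x\<close> into \<open>X3\<close>. The
    choice of \<open>q e\<close> then brings \<open>e\<close> into the section too.\<close>
  have "q e \<in> sec L'"
  proof (rule ccontr)
    assume "q e \<notin> sec L'"
    moreover have "q e \<in> {0..1}"
      using q_carrier(1)[OF e(1)] C_unit by blast
    ultimately have "x \<in> X3"
      unfolding X3_def meet_def using L' e(1) x(2) by blast
    then show False
      using x(6) by simp
  qed
  then have "(e, None) \<in> L'"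
    using Hq[OF L'(1)] unfolding sec_def by simp
  \<comment> \<open>The pairwise meeting points lie over \<open>q z\<close>, \<open>q e\<close> and
    \<open>e\<close>: the first two in the fiber of \<open>x\<close>, the last on the spine.\<close>
  have "M \<inter> L \<inter> L' \<noteq> {}"
  proof (rule kset_binary[OF bin M(1) \<G>(2)[OF L(1)] H(2)[OF L'(1)]])
    show "M \<inter> L \<noteq> {}"
      using L(2) q_carrier(3)[OF \<open>z \<in> E\<close>] by blast
    show "M \<inter> L' \<noteq> {}"
      using L'(2) q_carrier(3)[OF e(1)] by blast
    show "L \<inter> L' \<noteq> {}"
      using e(2) \<open>(e, None) \<in> L'\<close> by blast
  qed
  then obtain y where y: "y \<in> C x" "(y, Some (h x)) \<in> L" "(y, Some (h x)) \<in> L'"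
    using M(2) unfolding fiber_def by auto
  \<comment> \<open>The common point lies right of \<open>p e\<close> and outside the gap, hence at
    or beyond \<open>q e\<close>. There \<open>L\<close> has no point in the fiber, as
    \<open>x\<close> is not in \<open>X2\<close>.\<close>
  have "y \<in> ball e (r/2)"
    using y(3) L'(1) H(4) by blast
  then have "\<bar>e - y\<bar> < r / 2"
    by (simp add: dist_real_def)
  then have "p e < y"
    using pq(4)[of e] by linarith
  moreover have "y \<notin> {p e<..<q e}"
    using JC[OF x(1) e(1)] y(1) by blast
  ultimately have "y \<in> {q (top L)..} \<inter> {0..1}"
    using y(1) C_unit unfolding e_def by fastforce
  then have "x \<in> X2"
    unfolding X2_def meet_def using L(1) \<open>sec L \<noteq> {}\<close> x(2) y(2) by blast
  then show False
    using x(5) by simp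
qed

end

theorem theorem5p1:
  fixes D :: "'d set"
  assumes "non_M \<le>o |D|"
  shows "\<exists>X. closedin (prod_topology (top_of_set {0..1::real}) (Alexandroff_compactification (discrete_topology D))) X \<and>
           weight (subtopology (prod_topology (top_of_set {0..1}) (Alexandroff_compactification (discrete_topology D))) X) =o non_M \<and>
           \<not> supercompact (subtopology (prod_topology (top_of_set {0..1}) (Alexandroff_compactification (discrete_topology D))) X)"
proof -
  obtain A :: "real set" where A: "\<not> meager A" "non_M = |A|"
    using least_cardinality[of "\<lambda>A::real set. \<not> meager A", OF not_meager_UNIV_real]
    unfolding non_M_def by metis
  obtain h where h: "inj_on h A" "h ` A \<subseteq> D"
    using assms unfolding A(2) card_of_ordLeq[symmetric] by blast
  interpret comb A h D "\<lambda>x. cantor (bits x)"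
  proof
    show "cantor (bits x) \<subseteq> {0..1}" for x
      unfolding cantor_def by auto
    show "cantor (bits x) \<noteq> {}" for x
      using zero_in_cantor by auto
  qed (use h closed_cantor in auto)
  \<comment> \<open>The weight computation is for infinite \<open>A\<close>; a countable set of
    reals is meager.\<close>
  have "infinite A"
    using A(1) countable_imp_meager countable_finite by blast
  have "\<not> supercompact comb_top"
    by (rule not_supercompact[OF A(1)], erule cantor_gaps_prescribable, assumption+) blast
  then show ?thesis
    using closedin_carrier weight_comb_top[OF \<open>infinite A\<close>]
    unfolding A(2) comb_top_def ambient_def by blast
qed

end
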